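(* For every countable ordinal $\xi$ with $1\le \xi<\omega_1$, the following equality of classes of subsets of Baire space $\omega^\omega$ holds: $$\mathbf{\Delta}^0_{\xi+1} = \bigcup_{1\le \eta<\omega_1} D_\eta(\mathbf{\Sigma}^0_\xi).$$
   Context: All sets are subsets of Baire space $\mathcal N=\omega^\omega$; $\mathbf\Sigma^0_\xi$, $\mathbf\Delta^0_\xi$ are the usual (boldface) Borel classes. Parity: every ordinal is uniquely $\mu+n$ with $\mu$ zero or a limit and $n<\omega$; its parity is the parity of $n$ (so $0$ and limit ordinals are even). Difference hierarchy: for a boldface pointclass $\mathbf\Gamma$ and a countable ordinal $\eta\ge 1$, $D_\eta(\mathbf\Gamma)$ is the class of all sets of the form $$A=\bigcup\Big\{ A_i\setminus \bigcup_{j<i}A_j \;:\; i<\eta,\ \mathrm{parity}(i)\ne \mathrm{parity}(\eta)\Big\},$$ where $\langle A_i\rangle_{i<\eta}$ is an increasing (with respect to $\subseteq$) sequence of sets from $\mathbf\Gamma$. *)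

theory Defs
  imports "HOL-Analysis.Analysis" "HOL-Library.Countable_Set_Type"
begin

section \<open>Countable ordinals\<close>

text \<open>
  The countable ordinals are the points of the initial well-order of cardinality \<open>\<aleph>\<^sub>1\<close>, that
  is, of the cardinal successor of \<open>natLeq\<close>; the order type of this type is \<open>\<omega>\<^sub>1\<close>. The lemmas
  \<open>countable_below\<close> and \<open>uncountable_omega1\<close> below characterize it among well-orders.
\<close>

typedef omega1 = "Field (cardSuc natLeq)"
  using Field_cardSuc_not_empty[OF natLeq_Card_order] by blast

instantiation omega1 :: wellorder
begin

definition less_eq_omega1 :: "omega1 \<Rightarrow> omega1 \<Rightarrow> bool"
  where "\<alpha> \<le> \<beta> \<longleftrightarrow> (Rep_omega1 \<alpha>, Rep_omega1 \<beta>) \<in> cardSuc natLeq"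

definition less_omega1 :: "omega1 \<Rightarrow> omega1 \<Rightarrow> bool"
  where "\<alpha> < \<beta> \<longleftrightarrow> \<alpha> \<le> \<beta> \<and> \<alpha> \<noteq> (\<beta> :: omega1)"

instance
proof
  let ?r = "cardSuc natLeq"
  have wo: "Well_order ?r"
    using cardSuc_Card_order[OF natLeq_Card_order] card_order_on_well_order_on by blast
  then have lin: "Linear_order ?r" and wf: "wf (?r - Id)"
    by (auto simp: well_order_on_def)
  then have refl: "Refl ?r" and trans: "trans ?r" and anti: "antisym ?r" and tot: "Total ?r"
    by (auto simp: linear_order_on_def partial_order_on_def preorder_on_def)
  show le_refl: "\<alpha> \<le> \<alpha>" for \<alpha> :: omega1
    using refl Rep_omega1 by (auto simp: less_eq_omega1_def refl_on_def)
  show "\<alpha> \<le> \<gamma>" if "\<alpha> \<le> \<beta>" "\<beta> \<le> \<gamma>" for \<alpha> \<beta> \<gamma> :: omega1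
    using that trans unfolding less_eq_omega1_def by (meson transD)
  show le_anti: "\<alpha> = \<beta>" if "\<alpha> \<le> \<beta>" "\<beta> \<le> \<alpha>" for \<alpha> \<beta> :: omega1
    using that anti unfolding less_eq_omega1_def by (meson antisymD Rep_omega1_inject)
  show "(\<alpha> < \<beta>) = (\<alpha> \<le> \<beta> \<and> \<not> \<beta> \<le> \<alpha>)" for \<alpha> \<beta> :: omega1
    using le_anti le_refl by (auto simp: less_omega1_def)
  show "\<alpha> \<le> \<beta> \<or> \<beta> \<le> \<alpha>" for \<alpha> \<beta> :: omega1
  proof (cases "\<alpha> = \<beta>")
    case False
    then show ?thesis
      using tot Rep_omega1[of \<alpha>] Rep_omega1[of \<beta>]
      unfolding less_eq_omega1_def total_on_def by (metis Rep_omega1_inject)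
  qed (use le_refl in auto)
  show "P \<alpha>" if step: "\<And>\<alpha>. (\<And>\<beta>. \<beta> < \<alpha> \<Longrightarrow> P \<beta>) \<Longrightarrow> P \<alpha>" for P and \<alpha> :: omega1
  proof -
    have "wf {(\<beta>, \<alpha>). \<beta> < (\<alpha> :: omega1)}"
      by (rule wf_subset[OF wf_inv_image[OF wf, of Rep_omega1]])
        (auto simp: inv_image_def less_omega1_def less_eq_omega1_def Rep_omega1_inject)
    then show ?thesis
      by (induction \<alpha> rule: wf_induct_rule) (use step in auto)
  qed
qed

end

lemma countable_below: "countable {..< \<alpha> :: omega1}"
proof -
  include cardinal_syntax
  let ?r = "cardSuc natLeq"
  have "|underS ?r (Rep_omega1 \<alpha>)| <o ?r"
    using card_of_underS[OF cardSuc_Card_order[OF natLeq_Card_order] Rep_omega1] .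
  then have "|underS ?r (Rep_omega1 \<alpha>)| \<le>o natLeq"
    using cardSuc_ordLeq_ordLess[OF natLeq_Card_order card_of_Card_order] by blast
  then have "countable (underS ?r (Rep_omega1 \<alpha>))"
    by (simp add: countable_card_le_natLeq)
  moreover have "Rep_omega1 ` {..<\<alpha>} \<subseteq> underS ?r (Rep_omega1 \<alpha>)"
    by (auto simp: underS_def less_omega1_def less_eq_omega1_def Rep_omega1_inject)
  ultimately show ?thesis
    by (meson countable_subset countable_image_inj_on inj_onI Rep_omega1_inject)
qed

lemma uncountable_omega1: "uncountable (UNIV :: omega1 set)"
proof
  include cardinal_syntax
  let ?r = "cardSuc natLeq"
  assume "countable (UNIV :: omega1 set)"
  then have "countable (Field ?r)"
    using type_definition.Rep_range[OF type_definition_omega1] by (metis countable_image)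
  then have "|Field ?r| \<le>o natLeq"
    by (simp add: countable_card_le_natLeq)
  then have "?r \<le>o natLeq"
    using card_of_Field_ordIso[OF cardSuc_Card_order[OF natLeq_Card_order]]
      ordIso_ordLeq_trans ordIso_symmetric by blast
  then show False
    using cardSuc_greater[OF natLeq_Card_order] not_ordLess_ordLeq by blast
qed

definition osuc :: "omega1 \<Rightarrow> omega1"
  where "osuc \<alpha> = (LEAST \<beta>. \<alpha> < \<beta>)"

lemma ex_greater_omega1: "\<exists>\<beta>. (\<alpha> :: omega1) < \<beta>"
proof (rule ccontr)
  assume "\<not> ?thesis"
  then have "UNIV = insert \<alpha> {..<\<alpha>}"
    by (auto simp: not_less le_less)
  then show False
    using countable_below[of \<alpha>] uncountable_omega1 by (metis countable_insert)
qed

lemma less_osuc: "\<alpha> < osuc \<alpha>"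
  unfolding osuc_def by (rule LeastI_ex[OF ex_greater_omega1])

lemma osuc_le_iff: "osuc \<alpha> \<le> \<beta> \<longleftrightarrow> \<alpha> < \<beta>"
  using less_osuc[of \<alpha>] Least_le[of "\<lambda>\<beta>. \<alpha> < \<beta>" \<beta>] by (auto simp: osuc_def)

lemma less_osuc_iff: "\<beta> < osuc \<alpha> \<longleftrightarrow> \<beta> \<le> \<alpha>"
  using osuc_le_iff[of \<alpha> \<beta>] by (simp add: not_le[symmetric])

lemma osuc_inject: "osuc \<alpha> = osuc \<beta> \<longleftrightarrow> \<alpha> = \<beta>"
  by (metis order_antisym_conv less_osuc_iff order_refl)

instantiation omega1 :: zero_neq_one
begin

definition zero_omega1 :: omega1
  where "0 = (LEAST \<alpha> :: omega1. True)"

definition one_omega1 :: omega1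
  where "1 = osuc 0"

instance
  by standard (metis less_osuc one_omega1_def less_irrefl)

end

lemma omega1_zero_le: "0 \<le> (\<alpha> :: omega1)"
  by (simp add: zero_omega1_def Least_le)

definition is_limit :: "omega1 \<Rightarrow> bool"
  where "is_limit \<mu> \<longleftrightarrow> \<mu> \<noteq> 0 \<and> (\<nexists>\<alpha>. \<mu> = osuc \<alpha>)"

text \<open>Here \<open>(osuc ^^ n) \<mu>\<close> is the ordinal \<open>\<mu> + n\<close>.\<close>

lemma omega1_decomposition:
  "\<exists>!(\<mu>, n). (\<mu> = 0 \<or> is_limit \<mu>) \<and> \<alpha> = (osuc ^^ n) \<mu>"
proof -
  have ex: "\<exists>\<mu> n. (\<mu> = 0 \<or> is_limit \<mu>) \<and> \<alpha> = (osuc ^^ n) \<mu>"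
  proof (induction \<alpha> rule: less_induct)
    case (less \<alpha>)
    show ?case
    proof (cases "\<alpha> = 0 \<or> is_limit \<alpha>")
      case True
      then show ?thesis by (metis funpow_0)
    next
      case False
      then obtain \<beta> where \<beta>: "\<alpha> = osuc \<beta>" by (auto simp: is_limit_def)
      then obtain \<mu> n where "\<mu> = 0 \<or> is_limit \<mu>" "\<beta> = (osuc ^^ n) \<mu>"
        using less.IH less_osuc by blast
      then have "(\<mu> = 0 \<or> is_limit \<mu>) \<and> \<alpha> = (osuc ^^ Suc n) \<mu>"
        using \<beta> by simp
      then show ?thesis by blast
    qed
  qed
  have base: "\<mu> \<noteq> osuc \<beta>" if "\<mu> = 0 \<or> is_limit \<mu>" for \<mu> \<beta>
    using that less_osuc[of \<beta>] omega1_zero_le[of \<beta>] by (auto simp: is_limit_def)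
  have unique: "\<mu> = \<nu> \<and> m = n"
    if "\<mu> = 0 \<or> is_limit \<mu>" "\<nu> = 0 \<or> is_limit \<nu>" "(osuc ^^ m) \<mu> = (osuc ^^ n) \<nu>" for \<mu> \<nu> m n
    using that(3)
  proof (induction m arbitrary: n)
    case 0
    then show ?case using base[OF that(1)] by (cases n) auto
  next
    case (Suc m)
    then show ?case using base[OF that(2), symmetric] by (cases n) (auto simp: osuc_inject)
  qed
  from ex obtain \<mu> n where \<mu>: "\<mu> = 0 \<or> is_limit \<mu>" "\<alpha> = (osuc ^^ n) \<mu>"
    by blast
  show ?thesis
  proof (rule ex1I[of _ "(\<mu>, n)"])
    fix p
    assume "case p of (\<mu>, n) \<Rightarrow> (\<mu> = 0 \<or> is_limit \<mu>) \<and> \<alpha> = (osuc ^^ n) \<mu>"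
    then have "fst p = 0 \<or> is_limit (fst p)" "(osuc ^^ snd p) (fst p) = (osuc ^^ n) \<mu>"
      using \<mu>(2) by (auto split: prod.splits)
    then show "p = (\<mu>, n)"
      using unique[OF _ \<mu>(1)] by (metis prod.collapse)
  qed (use \<mu> in simp)
qed

definition even_ord :: "omega1 \<Rightarrow> bool"
  where "even_ord \<alpha> \<longleftrightarrow> (\<exists>\<mu> n. (\<mu> = 0 \<or> is_limit \<mu>) \<and> \<alpha> = (osuc ^^ n) \<mu> \<and> even n)"

section \<open>The Borel hierarchy\<close>

text \<open>The classes are indexed by \<open>\<xi> \<ge> 1\<close>; \<open>Sigma0 0\<close> is empty.\<close>

inductive is_Sigma0 :: "omega1 \<Rightarrow> 'a :: topological_space set \<Rightarrow> bool" where
  Open: "open U \<Longrightarrow> is_Sigma0 1 U"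
| Union: "1 < \<xi> \<Longrightarrow> (\<And>n :: nat. 1 \<le> \<zeta> n) \<Longrightarrow> (\<And>n. \<zeta> n < \<xi>) \<Longrightarrow>
    (\<And>n. is_Sigma0 (\<zeta> n) (- A n)) \<Longrightarrow> is_Sigma0 \<xi> (\<Union>n. A n)"

definition Sigma0 :: "omega1 \<Rightarrow> 'a :: topological_space set set"
  where "Sigma0 \<xi> = {A. is_Sigma0 \<xi> A}"

definition Pi0 :: "omega1 \<Rightarrow> 'a :: topological_space set set"
  where "Pi0 \<xi> = {A. - A \<in> Sigma0 \<xi>}"

lemma Sigma0_one: "Sigma0 1 = {U. open U}"
  by (auto simp: Sigma0_def intro: is_Sigma0.Open elim: is_Sigma0.cases)

lemma Sigma0_eq:
  assumes "1 < \<xi>"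
  shows "Sigma0 \<xi> = {\<Union>n :: nat. A n | A. \<forall>n. \<exists>\<zeta>. 1 \<le> \<zeta> \<and> \<zeta> < \<xi> \<and> A n \<in> Pi0 \<zeta>}"
    (is "_ = ?R")
proof
  show "Sigma0 \<xi> \<subseteq> ?R"
    using assms by (auto simp: Sigma0_def Pi0_def elim!: is_Sigma0.cases) metis
  show "?R \<subseteq> Sigma0 \<xi>"
  proof
    fix B assume "B \<in> ?R"
    then obtain A where B: "B = (\<Union>n :: nat. A n)"
      and "\<forall>n. \<exists>\<zeta>. 1 \<le> \<zeta> \<and> \<zeta> < \<xi> \<and> is_Sigma0 \<zeta> (- A n)"
      by (auto simp: Sigma0_def Pi0_def)
    then obtain \<zeta> where "\<And>n. 1 \<le> \<zeta> n \<and> \<zeta> n < \<xi> \<and> is_Sigma0 (\<zeta> n) (- A n)"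
      by metis
    then show "B \<in> Sigma0 \<xi>"
      unfolding B Sigma0_def by (auto intro!: is_Sigma0.Union[OF assms, of \<zeta>])
  qed
qed

definition Delta0 :: "omega1 \<Rightarrow> 'a :: topological_space set set"
  where "Delta0 \<xi> = Sigma0 \<xi> \<inter> Pi0 \<xi>"

section \<open>The difference hierarchy\<close>

definition difference_class :: "omega1 \<Rightarrow> 'a set set \<Rightarrow> 'a set set"
  where "difference_class \<eta> \<Gamma> =
    {\<Union> {A i - (\<Union>j\<in>{..<i}. A j) | i. i < \<eta> \<and> even_ord i \<noteq> even_ord \<eta>} | A.
      (\<forall>i<\<eta>. A i \<in> \<Gamma>) \<and> (\<forall>i j. i \<le> j \<and> j < \<eta> \<longrightarrow> A i \<subseteq> A j)}"

text \<open>
  Baire space. The library puts the product topology on \<^typ>\<open>nat \<Rightarrow> nat\<close>, with the discrete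
  topology on each factor.
\<close>

type_synonym baire = "nat \<Rightarrow> nat"

end

theory Submission
  imports Defs
begin

text \<open>
  Let \<open>A\<close> and its complement be countable unions of \<open>\<Pi>\<^sub>\<xi>\<close> sets. Unfolding the definitions of these
  sets down to open sets gives a countable family of sets of lower rank; together with a base of
  the topology it generates a finer topology whose open sets are \<open>\<Sigma>\<^sub>\<xi>\<close>, in which all
  these \<open>\<Pi>\<^sub>\<xi>\<close> sets are closed and whose closed subspaces satisfy the Baire category theorem.
  Hence every nonempty set closed in the finer topology has a nonempty relatively open part inside
  \<open>A\<close> or inside the complement of \<open>A\<close>. Removing these parts alternately, at even stages those
  outside \<open>A\<close> and at odd stages those inside, exhausts the space after countably many steps,
  since the base is countable; the increasing removed open sets witness that \<open>A\<close> lies in the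
  difference hierarchy.
\<close>

section \<open>Closure properties of the Borel classes\<close>

lemma topological_basis_closure_subset:
  fixes S :: "'a::metric_space set"
  assumes "topological_basis B" "open S" "x \<in> S"
  shows "\<exists>T\<in>B. x \<in> T \<and> closure T \<subseteq> S"
proof -
  obtain e where e: "e > 0" "cball x e \<subseteq> S"
    using assms open_contains_cball by blast
  obtain T where T: "T \<in> B" "x \<in> T" "T \<subseteq> ball x e"
    using topological_basisE[OF assms(1), of "ball x e" x] e by auto
  have "closure T \<subseteq> cball x e"
    using T by (intro closure_minimal) auto
  with T e show ?thesis by blast
qed

lemma Pi0_subset_Sigma0:
  assumes "1 \<le> \<zeta>" "\<zeta> < \<xi>" "- A \<in> Sigma0 \<zeta>"
  shows "A \<in> Sigma0 \<xi>"
proof -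
  have "1 < \<xi>" using assms by order
  have "is_Sigma0 \<xi> (\<Union>n::nat. A)"
    using assms \<open>1 < \<xi>\<close> by (intro is_Sigma0.Union[of \<xi> "\<lambda>_. \<zeta>"]) (auto simp: Sigma0_def)
  then show ?thesis by (simp add: Sigma0_def)
qed

text \<open>By regularity, an open set is the union of the countably many closures of basic sets
  that fit inside it. This F-sigma representation is the passage from rank 1 to higher
  ranks.\<close>

lemma open_in_Sigma0:
  fixes U :: "'a::{metric_space, second_countable_topology} set"
  assumes "1 \<le> \<xi>" "open U"
  shows "U \<in> Sigma0 \<xi>"
proof (cases "\<xi> = 1")
  case True
  then show ?thesis using assms by (simp add: Sigma0_one)
next
  case False
  then have "1 < \<xi>" using assms by order
  obtain B :: "'a set set" where B: "countable B" "topological_basis B"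
    using ex_countable_basis by blast
  \<comment> \<open>The empty set keeps \<open>K\<close> nonempty for \<open>from_nat_into\<close>,
    even if \<open>U\<close> is empty.\<close>
  define K where "K = insert {} (closure ` {T\<in>B. closure T \<subseteq> U})"
  have K: "countable K" "K \<noteq> {}" "\<And>C. C \<in> K \<Longrightarrow> closed C"
    using B(1) by (auto simp: K_def)
  have "U \<subseteq> \<Union>K"
  proof
    fix x assume "x \<in> U"
    then obtain T where "T \<in> B" "x \<in> T" "closure T \<subseteq> U"
      using topological_basis_closure_subset[OF B(2) assms(2)] by blast
    then show "x \<in> \<Union>K"
      using closure_subset[of T] by (auto simp: K_def)
  qed
  then have "U = \<Union>K"
    by (auto simp: K_def)
  also have "\<dots> = (\<Union>n. from_nat_into K n)"
    using K by (metis range_from_nat_into)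
  also have "\<dots> \<in> Sigma0 \<xi>"
    using K \<open>1 < \<xi>\<close> from_nat_into[OF K(2)] unfolding Sigma0_def mem_Collect_eq
    by (intro is_Sigma0.Union[of \<xi> "\<lambda>_. 1"] is_Sigma0.Open) auto
  finally show ?thesis .
qed

text \<open>Above rank 1 the same sequence of pieces serves, since the ranks of the pieces are only
  bounded from above. Rank 1 is the case of open sets.\<close>

lemma Sigma0_mono:
  fixes A :: "'a::{metric_space, second_countable_topology} set"
  assumes "A \<in> Sigma0 \<zeta>" "1 \<le> \<zeta>" "\<zeta> \<le> \<xi>"
  shows "A \<in> Sigma0 \<xi>"
proof (cases "\<zeta> = 1")
  case True
  then show ?thesis using assms open_in_Sigma0 by (auto simp: Sigma0_one)
next
  case False
  then have "1 < \<zeta>" "1 < \<xi>" using assms by order+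
  then obtain F where "A = (\<Union>n::nat. F n)" "\<And>n. \<exists>\<zeta>'. 1 \<le> \<zeta>' \<and> \<zeta>' < \<zeta> \<and> F n \<in> Pi0 \<zeta>'"
    using assms(1) by (auto simp: Sigma0_eq)
  moreover from this(2) have "\<forall>n. \<exists>\<zeta>'. 1 \<le> \<zeta>' \<and> \<zeta>' < \<xi> \<and> F n \<in> Pi0 \<zeta>'"
    using assms(3) by (meson less_le_trans)
  ultimately show ?thesis
    unfolding Sigma0_eq[OF \<open>1 < \<xi>\<close>] by blast
qed

lemma Sigma0_countable_Union:
  fixes K :: "'a::{metric_space, second_countable_topology} set set"
  assumes "1 \<le> \<xi>" "countable K" "K \<subseteq> Sigma0 \<xi>"
  shows "\<Union>K \<in> Sigma0 \<xi>"
proof (cases "\<xi> = 1 \<or> K = {}")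
  case True
  then show ?thesis using assms open_in_Sigma0[OF assms(1), of "{}"]
    by (auto simp: Sigma0_one intro!: open_Union)
next
  case False
  then have \<xi>: "1 < \<xi>" and "K \<noteq> {}" using assms by auto
  define f where "f = from_nat_into K"
  have K: "\<Union>K = (\<Union>n. f n)"
    using \<open>K \<noteq> {}\<close> assms(2) by (metis f_def range_from_nat_into)
  have "f n \<in> Sigma0 \<xi>" for n
    using assms(3) from_nat_into[OF \<open>K \<noteq> {}\<close>] by (auto simp: f_def)
  then have "\<forall>n. \<exists>A. f n = (\<Union>m::nat. A m) \<and> (\<forall>m. \<exists>\<zeta>. 1 \<le> \<zeta> \<and> \<zeta> < \<xi> \<and> A m \<in> Pi0 \<zeta>)"
    using \<xi> by (simp add: Sigma0_eq)
  then obtain A where A: "\<And>n. f n = (\<Union>m::nat. A n m)"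
    and A': "\<And>n m. \<exists>\<zeta>. 1 \<le> \<zeta> \<and> \<zeta> < \<xi> \<and> A n m \<in> Pi0 \<zeta>"
    by metis
  \<comment> \<open>Pairing flattens the double sequence of pieces into one sequence.\<close>
  have "\<Union>K = (\<Union>p. case prod_decode p of (n, m) \<Rightarrow> A n m)"
  proof -
    have "(\<Union>p. case prod_decode p of (n, m) \<Rightarrow> A n m) = (\<Union>(n, m)\<in>range prod_decode. A n m)"
      by (simp add: image_image)
    then show ?thesis unfolding K A by (auto simp: surj_prod_decode)
  qed
  moreover have "\<exists>\<zeta>. 1 \<le> \<zeta> \<and> \<zeta> < \<xi> \<and> (case prod_decode p of (n, m) \<Rightarrow> A n m) \<in> Pi0 \<zeta>" for p
    using A' by (simp split: prod.splits)
  ultimately show ?thesis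
    unfolding Sigma0_eq[OF \<xi>] by blast
qed

lemma Sigma0_Un:
  fixes A :: "'a::{metric_space, second_countable_topology} set"
  assumes "1 \<le> \<xi>" "A \<in> Sigma0 \<xi>" "B \<in> Sigma0 \<xi>"
  shows "A \<union> B \<in> Sigma0 \<xi>"
  using Sigma0_countable_Union[of \<xi> "{A, B}"] assms by simp

text \<open>Intersection distributes over the two unions, and \<open>f n \<inter> g m\<close> is the
  complement of a union of two sets of rank \<open>max \<zeta> \<zeta>'\<close>, which is still
  below \<open>\<xi>\<close>.\<close>

lemma Sigma0_Int:
  fixes A :: "'a::{metric_space, second_countable_topology} set"
  assumes "1 \<le> \<xi>" "A \<in> Sigma0 \<xi>" "B \<in> Sigma0 \<xi>"
  shows "A \<inter> B \<in> Sigma0 \<xi>"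
proof (cases "\<xi> = 1")
  case True
  then show ?thesis using assms by (auto simp: Sigma0_one)
next
  case False
  then have \<xi>: "1 < \<xi>" using assms by order
  obtain f g where f: "A = (\<Union>n::nat. f n)" "\<And>n. \<exists>\<zeta>. 1 \<le> \<zeta> \<and> \<zeta> < \<xi> \<and> f n \<in> Pi0 \<zeta>"
    and g: "B = (\<Union>n::nat. g n)" "\<And>n. \<exists>\<zeta>. 1 \<le> \<zeta> \<and> \<zeta> < \<xi> \<and> g n \<in> Pi0 \<zeta>"
    using assms \<xi> by (auto simp: Sigma0_eq)
  have "f n \<inter> g m \<in> Sigma0 \<xi>" for n m
  proof -
    obtain \<zeta> \<zeta>' where \<zeta>: "1 \<le> \<zeta>" "\<zeta> < \<xi>" "- f n \<in> Sigma0 \<zeta>" "1 \<le> \<zeta>'" "\<zeta>' < \<xi>" "- g m \<in> Sigma0 \<zeta>'"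
      using f(2) g(2) unfolding Pi0_def by blast
    have "- f n \<union> - g m \<in> Sigma0 (max \<zeta> \<zeta>')"
      using \<zeta> Sigma0_mono[OF \<zeta>(3,1), of "max \<zeta> \<zeta>'"] Sigma0_mono[OF \<zeta>(6,4), of "max \<zeta> \<zeta>'"]
      by (intro Sigma0_Un) (simp_all add: le_max_iff_disj)
    then show ?thesis
      using \<zeta> Pi0_subset_Sigma0[of "max \<zeta> \<zeta>'" \<xi> "f n \<inter> g m"]
      by (simp add: le_max_iff_disj)
  qed
  then have "\<Union>(range (\<lambda>(n, m). f n \<inter> g m)) \<in> Sigma0 \<xi>"
    using assms by (intro Sigma0_countable_Union) auto
  moreover have "A \<inter> B = \<Union>(range (\<lambda>(n, m). f n \<inter> g m))"
    unfolding f(1) g(1) by auto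
  ultimately show ?thesis by simp
qed

lemma Sigma0_finite_Inter:
  fixes K :: "'a::{metric_space, second_countable_topology} set set"
  assumes "1 \<le> \<xi>" "finite K" "K \<subseteq> Sigma0 \<xi>"
  shows "\<Inter>K \<in> Sigma0 \<xi>"
  using assms(2,3) by induction (simp_all add: Sigma0_Int[OF assms(1)] open_in_Sigma0[OF assms(1)])

section \<open>Differences of \<open>\<Sigma>\<^sub>\<xi>\<close> sets\<close>

text \<open>A point of some \<open>A i\<close> with \<open>i < \<eta>\<close> lies in exactly one
  difference, so the complement consists of the differences not selected and the points outside all
  \<open>A i\<close>. As \<open>\<eta>\<close> is countable, only countable unions occur.\<close>

lemma difference_class_subset_Delta0:
  fixes D :: "'a::{metric_space, second_countable_topology} set"
  assumes "1 \<le> \<xi>" "D \<in> difference_class \<eta> (Sigma0 \<xi>)"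
  shows "D \<in> Delta0 (osuc \<xi>)"
proof -
  obtain A where D: "D = \<Union>{A i - (\<Union>j\<in>{..<i}. A j) | i. i < \<eta> \<and> even_ord i \<noteq> even_ord \<eta>}"
    and A: "\<And>i. i < \<eta> \<Longrightarrow> A i \<in> Sigma0 \<xi>"
    using assms(2) unfolding difference_class_def by (elim CollectE exE conjE) (rule that, assumption, blast)
  have less: "\<xi> < osuc \<xi>" by (rule less_osuc)
  then have one: "1 \<le> osuc \<xi>" using assms(1) by order
  define d where "d i = A i - (\<Union>j\<in>{..<i}. A j)" for i
  \<comment> \<open>The bound includes \<open>i = \<eta>\<close>, which is needed for the points in
    no \<open>A j\<close> at all.\<close>
  have co: "- (\<Union>j\<in>{..<i}. A j) \<in> Sigma0 (osuc \<xi>)" if "i \<le> \<eta>" for i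
  proof (rule Pi0_subset_Sigma0[OF assms(1) less])
    show "- (- (\<Union>j\<in>{..<i}. A j)) \<in> Sigma0 \<xi>"
      using that A Sigma0_countable_Union[OF assms(1), of "A ` {..<i}"] countable_below[of i]
      by (simp add: image_subset_iff)
  qed
  have d: "d i \<in> Sigma0 (osuc \<xi>)" if "i < \<eta>" for i
    unfolding d_def Diff_eq
    using that Sigma0_mono[OF A[OF that] assms(1) less_imp_le[OF less]]
    by (intro Sigma0_Int[OF one] co) auto
  have part: "\<Union>(d ` {i. i < \<eta> \<and> P i}) \<in> Sigma0 (osuc \<xi>)" for P
    using d countable_subset[OF _ countable_below[of \<eta>], of "{i. i < \<eta> \<and> P i}"]
    by (intro Sigma0_countable_Union[OF one]) auto
  have D': "D = \<Union>(d ` {i. i < \<eta> \<and> even_ord i \<noteq> even_ord \<eta>})"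
    unfolding D d_def by (simp add: image_Collect)
  have ex1: "\<exists>i<\<eta>. x \<in> d i" if "i < \<eta>" "x \<in> A i" for x i
  proof -
    define l where "l = (LEAST i. x \<in> A i)"
    have "x \<in> A l" "l \<le> i" unfolding l_def using that(2) by (rule LeastI Least_le)+
    moreover have "x \<notin> A j" if "j < l" for j
      using that not_less_Least unfolding l_def by blast
    ultimately show ?thesis using that by (intro exI[of _ l]) (auto simp: d_def)
  qed
  have unique: "i = j" if "x \<in> d i" "x \<in> d j" for x i j
    using that by (cases i j rule: linorder_cases) (auto simp: d_def)
  have "- D = \<Union>(d ` {i. i < \<eta> \<and> even_ord i = even_ord \<eta>}) \<union> - (\<Union>j\<in>{..<\<eta>}. A j)"
  proof (intro equalityI subsetI)
    fix x assume "x \<in> - D"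
    then show "x \<in> \<Union>(d ` {i. i < \<eta> \<and> even_ord i = even_ord \<eta>}) \<union> - (\<Union>j\<in>{..<\<eta>}. A j)"
      using ex1[of _ x] unfolding D' by blast
  next
    fix x assume "x \<in> \<Union>(d ` {i. i < \<eta> \<and> even_ord i = even_ord \<eta>}) \<union> - (\<Union>j\<in>{..<\<eta>}. A j)"
    then show "x \<in> - D"
    proof
      assume "x \<in> \<Union>(d ` {i. i < \<eta> \<and> even_ord i = even_ord \<eta>})"
      then show ?thesis using unique[of x] unfolding D' by blast
    next
      assume "x \<in> - (\<Union>j\<in>{..<\<eta>}. A j)"
      then show ?thesis unfolding D' by (auto simp: d_def)
    qed
  qed
  also have "\<dots> \<in> Sigma0 (osuc \<xi>)"
    by (intro Sigma0_Un[OF one] part co) simp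
  finally show ?thesis
    using part D' by (simp add: Delta0_def Pi0_def)
qed

section \<open>The transfinite derivation\<close>

lemma even_ord_osuc: "even_ord (osuc \<alpha>) \<longleftrightarrow> \<not> even_ord \<alpha>"
proof -
  obtain \<mu> n where \<mu>: "\<mu> = 0 \<or> is_limit \<mu>" "\<alpha> = (osuc ^^ n) \<mu>"
    using omega1_decomposition[of \<alpha>] by blast
  then have \<mu>': "osuc \<alpha> = (osuc ^^ Suc n) \<mu>" by simp
  \<comment> \<open>Uniqueness of the decomposition lets parity be read off any one representation
    over \<open>\<mu>\<close>.\<close>
  have iff: "even_ord \<beta> \<longleftrightarrow> even m" if "\<beta> = (osuc ^^ m) \<mu>" for \<beta> m
  proof -
    have "\<mu>' = \<mu> \<and> m' = m" if "\<mu>' = 0 \<or> is_limit \<mu>'" "\<beta> = (osuc ^^ m') \<mu>'" for \<mu>' m'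
      using omega1_decomposition[of \<beta>] that \<mu>(1) \<open>\<beta> = (osuc ^^ m) \<mu>\<close> by blast
    then show ?thesis using that \<mu>(1) unfolding even_ord_def by blast
  qed
  show ?thesis using iff[OF \<mu>(2)] iff[OF \<mu>'] by simp
qed

text \<open>Otherwise the countably many countable initial segments below members of
  \<open>S\<close> would exhaust all countable ordinals.\<close>

lemma countable_omega1_bounded:
  fixes S :: "omega1 set"
  assumes "countable S"
  shows "\<exists>\<beta>. \<forall>\<alpha>\<in>S. \<alpha> \<le> \<beta>"
proof (rule ccontr)
  assume "\<not> ?thesis"
  then have "UNIV = (\<Union>\<alpha>\<in>S. {..<\<alpha>})"
    by (auto simp: not_le)
  moreover have "countable (\<Union>\<alpha>\<in>S. {..<\<alpha>})"
    using assms by (intro countable_UN) (auto intro: countable_below)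
  ultimately show False
    using uncountable_omega1 by simp
qed

text \<open>
  Writing the transfinite recursion for the removed open sets as a least fixed point avoids
  well-founded recursion.
\<close>

inductive stage :: "'a set set \<Rightarrow> (omega1 \<Rightarrow> 'a set) \<Rightarrow> omega1 \<Rightarrow> 'a \<Rightarrow> bool"
  for B X where
  stageI: "C \<in> B \<Longrightarrow> x \<in> C \<Longrightarrow> (\<And>y. y \<in> C \<Longrightarrow> y \<in> X \<alpha> \<or> (\<exists>\<beta><\<alpha>. stage B X \<beta> y)) \<Longrightarrow> stage B X \<alpha> x"

lemma stage_cell:
  assumes "stage B X \<alpha> x"
  obtains C where "C \<in> B" "x \<in> C" "C \<subseteq> {y. stage B X \<alpha> y}"
proof -
  obtain C where C: "C \<in> B" "x \<in> C" "\<And>y. y \<in> C \<Longrightarrow> y \<in> X \<alpha> \<or> (\<exists>\<beta><\<alpha>. stage B X \<beta> y)"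
    using assms by (auto elim: stage.cases)
  have "C \<subseteq> {y. stage B X \<alpha> y}"
    by (intro subsetI CollectI stageI[OF C(1)] C(3))
  then show thesis using that C by blast
qed

text \<open>This is what bounds the complexity of the stages: for countable \<open>B\<close> they
  are countable unions of members of \<open>B\<close>.\<close>

lemma stage_eq_Union: "{x. stage B X \<alpha> x} = \<Union>{C\<in>B. C \<subseteq> {x. stage B X \<alpha> x}}"
  by (auto elim: stage_cell)

lemma stage_mono:
  assumes "stage B X \<alpha> x" "\<alpha> \<le> \<beta>"
  shows "stage B X \<beta> x"
proof (cases "\<alpha> = \<beta>")
  case False
  then have "\<alpha> < \<beta>" using assms by simp
  obtain C where C: "C \<in> B" "x \<in> C" "C \<subseteq> {y. stage B X \<alpha> y}"
    using assms(1) by (rule stage_cell)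
  then show ?thesis
    using \<open>\<alpha> < \<beta>\<close> by (intro stageI[of C]) auto
qed (use assms in simp)

lemma stage_new:
  assumes "stage B X \<alpha> x" "\<And>\<beta>. \<beta> < \<alpha> \<Longrightarrow> \<not> stage B X \<beta> x"
  shows "x \<in> X \<alpha>"
  using assms by (auto elim: stage.cases)

text \<open>Countably many cells have countably many stages of first absorption, which are bounded,
  and every stage is a union of absorbed cells.\<close>

lemma stage_stabilizes:
  assumes "countable B"
  shows "\<exists>\<alpha>. \<forall>\<beta> x. stage B X \<beta> x \<longrightarrow> stage B X \<alpha> x"
proof -
  \<comment> \<open>For a cell that is never absorbed, \<open>l C\<close> is some unspecified
    ordinal; it may enlarge the bound but does no harm.\<close>
  define l where "l C = (LEAST \<alpha>. C \<subseteq> {x. stage B X \<alpha> x})" for C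
  obtain \<alpha> where \<alpha>: "\<And>C. C \<in> B \<Longrightarrow> l C \<le> \<alpha>"
    using countable_omega1_bounded[of "l ` B"] assms by auto
  have "stage B X \<alpha> x" if st: "stage B X \<beta> x" for \<beta> x
  proof -
    obtain C where C: "C \<in> B" "x \<in> C" "C \<subseteq> {x. stage B X \<beta> x}"
      using st by (rule stage_cell)
    from C(3) have "C \<subseteq> {x. stage B X (l C) x}"
      unfolding l_def by (rule LeastI)
    then show ?thesis using C \<alpha>[OF C(1)] stage_mono[of B X "l C" x] by blast
  qed
  then show ?thesis by blast
qed

text \<open>
  The hypothesis \<open>dense\<close> is the Baire category theorem for the topology generated by \<open>B\<close>,
  applied to closed sets split into \<open>A\<close> and its complement.
\<close>

lemma difference_class_if_dense:
  fixes A :: "'a::{metric_space, second_countable_topology} set"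
  assumes "1 \<le> \<xi>" "countable B" "B \<subseteq> Sigma0 \<xi>"
    and dense: "\<And>V. V \<subseteq> B \<Longrightarrow> \<Union>V \<noteq> UNIV \<Longrightarrow>
      \<exists>C\<in>B. \<not> C \<subseteq> \<Union>V \<and> (C \<subseteq> \<Union>V \<union> A \<or> C \<subseteq> \<Union>V \<union> - A)"
  shows "\<exists>\<eta>\<ge>1. A \<in> difference_class \<eta> (Sigma0 \<xi>)"
proof -
  define X where "X \<alpha> = (if even_ord \<alpha> then - A else A)" for \<alpha>
  define U where "U \<alpha> = {x. stage B X \<alpha> x}" for \<alpha>
  have U_Sigma0: "U \<alpha> \<in> Sigma0 \<xi>" for \<alpha>
    unfolding U_def by (subst stage_eq_Union)
      (use assms in \<open>auto intro!: Sigma0_countable_Union[OF assms(1)]\<close>)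
  have U_mono: "U \<alpha> \<subseteq> U \<beta>" if "\<alpha> \<le> \<beta>" for \<alpha> \<beta>
    using that stage_mono by (auto simp: U_def)
  have U_new: "x \<in> X \<alpha>" if "x \<in> U \<alpha>" "\<And>\<beta>. \<beta> < \<alpha> \<Longrightarrow> x \<notin> U \<beta>" for x \<alpha>
    using that stage_new[of B X \<alpha> x] by (simp add: U_def)
  obtain \<alpha> where \<alpha>: "\<And>\<beta>. U \<beta> \<subseteq> U \<alpha>"
    using stage_stabilizes[OF assms(2), of X] by (auto simp: U_def)
  \<comment> \<open>Both parities recur beyond the stable stage, so a remaining piece on either side
    of \<open>A\<close> would still get removed later.\<close>
  have ex_parity: "\<exists>\<beta>>\<alpha>. even_ord \<beta> = b" for b
    using even_ord_osuc[of \<alpha>] even_ord_osuc[of "osuc \<alpha>"] less_osuc[of \<alpha>] less_osuc[of "osuc \<alpha>"]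
    by (metis order_less_trans)
  have "U \<alpha> = UNIV"
  proof (rule ccontr)
    assume "U \<alpha> \<noteq> UNIV"
    moreover define V where "V = {C\<in>B. C \<subseteq> U \<alpha>}"
    have V: "V \<subseteq> B" "U \<alpha> = \<Union>V"
      unfolding V_def U_def by (blast, rule stage_eq_Union)
    ultimately obtain C where C: "C \<in> B" "\<not> C \<subseteq> U \<alpha>" "C \<subseteq> U \<alpha> \<union> A \<or> C \<subseteq> U \<alpha> \<union> - A"
      using dense[of V] by auto
    then obtain b where b: "C \<subseteq> U \<alpha> \<union> (if b then - A else A)"
      by (metis (full_types))
    obtain \<beta> where \<beta>: "\<alpha> < \<beta>" "even_ord \<beta> = b"
      using ex_parity by blast
    have "C \<subseteq> U \<beta>"
    proof
      fix x assume "x \<in> C"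
      then have "stage B X \<beta> x"
        by (rule stageI[OF C(1)]) (use b \<beta> in \<open>auto simp: U_def X_def\<close>)
      then show "x \<in> U \<beta>" by (simp add: U_def)
    qed
    then show False using C(2) \<alpha> by blast
  qed
  \<comment> \<open>With \<open>\<eta>\<close> even, the selected indices are the odd ones, where
    \<open>X\<close> is \<open>A\<close>; and \<open>\<alpha> < \<eta>\<close> makes every point
    enter before \<open>\<eta>\<close>.\<close>
  obtain \<eta> where \<eta>: "\<alpha> < \<eta>" "even_ord \<eta>"
    using ex_parity[of True] by auto
  have "A = \<Union>{U i - (\<Union>j\<in>{..<i}. U j) | i. i < \<eta> \<and> even_ord i \<noteq> even_ord \<eta>}" (is "_ = ?D")
  proof (intro equalityI subsetI)
    fix x assume "x \<in> A"
    define i where "i = (LEAST i. x \<in> U i)"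
    have i: "x \<in> U i" "i \<le> \<alpha>"
      unfolding i_def using \<open>U \<alpha> = UNIV\<close> by (auto intro: LeastI[of _ \<alpha>] Least_le)
    have i': "x \<notin> U j" if "j < i" for j
      using that not_less_Least unfolding i_def by blast
    have "\<not> even_ord i"
      using U_new[OF i(1) i'] \<open>x \<in> A\<close> by (auto simp: X_def split: if_splits)
    moreover have "i < \<eta>" using i \<eta> by order
    ultimately show "x \<in> ?D" using i i' \<eta> by blast
  next
    fix x assume "x \<in> ?D"
    then obtain i where "x \<in> U i" "\<And>j. j < i \<Longrightarrow> x \<notin> U j" "\<not> even_ord i"
      using \<eta> by blast
    then show "x \<in> A" using U_new[of x i] by (simp add: X_def)
  qed
  then have "A \<in> difference_class \<eta> (Sigma0 \<xi>)"
    unfolding difference_class_def using U_Sigma0 U_mono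
    by (intro CollectI exI[of _ U]) simp
  moreover have "1 \<le> \<eta>"
    using \<eta> omega1_zero_le[of \<alpha>] by (simp add: one_omega1_def osuc_le_iff)
  ultimately show ?thesis by blast
qed

section \<open>Baire category for refined topologies\<close>

text \<open>
  A set \<open>H\<close> of pairs \<open>(\<zeta>, E)\<close> records Borel sets with ranks. Basic open cells need their
  closure in \<open>S\<close> because the limit point of a chain is only known to lie in the closure of each
  of its members.
\<close>

definition cells :: "'a::topological_space set set \<Rightarrow> (omega1 \<times> 'a set) set \<Rightarrow> omega1 \<Rightarrow> 'a set \<Rightarrow> 'a set set"
  where "cells \<O> H \<xi> S = {T. T \<in> \<O> \<and> closure T \<subseteq> S \<or> T \<subseteq> S \<and> (\<exists>\<zeta><\<xi>. (\<zeta>, - T) \<in> H)}"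

lemma cells_subset: "T \<in> cells \<O> H \<xi> S \<Longrightarrow> T \<subseteq> S"
  using closure_subset by (auto simp: cells_def)

lemma cells_mono: "H \<subseteq> H' \<Longrightarrow> cells \<O> H \<xi> S \<subseteq> cells \<O> H' \<xi> S"
  by (auto simp: cells_def)

text \<open>Closure under unfolding: the cells covering a recorded set are basic open sets or
  complements of sets recorded in the same \<open>H\<close> at lower rank, so that induction on the
  rank stays inside \<open>H\<close>.\<close>

definition hereditary :: "'a::topological_space set set \<Rightarrow> omega1 \<Rightarrow> (omega1 \<times> 'a set) set \<Rightarrow> bool"
  where "hereditary \<O> \<xi> H \<longleftrightarrow> countable H \<and>
    (\<forall>\<zeta> E. (\<zeta>, E) \<in> H \<longrightarrow> 1 \<le> \<zeta> \<and> \<zeta> < \<xi> \<and> E \<in> Sigma0 \<zeta> \<and> E \<subseteq> \<Union>(cells \<O> H \<zeta> E))"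

lemma hereditaryD:
  assumes "hereditary \<O> \<xi> H" "(\<zeta>, E) \<in> H"
  shows "1 \<le> \<zeta>" "\<zeta> < \<xi>" "E \<in> Sigma0 \<zeta>" "E \<subseteq> \<Union>(cells \<O> H \<zeta> E)"
  using assms by (simp_all add: hereditary_def)

lemma hereditary_UN:
  assumes "countable I" "\<And>i. i \<in> I \<Longrightarrow> hereditary \<O> \<xi> (H i)"
  shows "hereditary \<O> \<xi> (\<Union>i\<in>I. H i)"
  unfolding hereditary_def
proof (intro conjI allI impI)
  show "countable (\<Union>i\<in>I. H i)"
    using assms by (auto simp: hereditary_def)
next
  fix \<zeta> E assume "(\<zeta>, E) \<in> (\<Union>i\<in>I. H i)"
  then obtain i where i: "i \<in> I" "(\<zeta>, E) \<in> H i" by blast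
  note D = hereditaryD[OF assms(2)[OF i(1)] i(2)]
  show "1 \<le> \<zeta>" "\<zeta> < \<xi>" "E \<in> Sigma0 \<zeta>" by (fact D)+
  have "cells \<O> (H i) \<zeta> E \<subseteq> cells \<O> (\<Union>i\<in>I. H i) \<zeta> E"
    using i(1) by (intro cells_mono) auto
  then show "E \<subseteq> \<Union>(cells \<O> (\<Union>i\<in>I. H i) \<zeta> E)"
    using D(4) Union_mono by blast
qed

text \<open>Induction on the construction of \<open>S\<close>. An open set needs no records, by
  regularity. For a union, the families of all \<open>- A n\<close> are merged and each
  \<open>- A n\<close> is added at rank \<open>\<zeta> n\<close>, which turns \<open>A n\<close>
  itself into a cell.\<close>

lemma ex_hereditary:
  fixes S :: "'a::metric_space set"
  assumes "topological_basis \<O>" "is_Sigma0 \<xi> S"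
  shows "\<exists>H. hereditary \<O> \<xi> H \<and> S \<subseteq> \<Union>(cells \<O> H \<xi> S)"
  using assms(2)
proof induction
  case (Open U)
  then have "U \<subseteq> \<Union>(cells \<O> {} 1 U)"
    using topological_basis_closure_subset[OF assms(1)] by (fastforce simp: cells_def)
  then show ?case by (intro exI[of _ "{}"]) (auto simp: hereditary_def)
next
  case (Union \<xi> \<zeta> A)
  have "\<forall>n. \<exists>H. hereditary \<O> (\<zeta> n) H \<and> - A n \<subseteq> \<Union>(cells \<O> H (\<zeta> n) (- A n))"
    using Union.IH by blast
  then obtain H where H: "\<And>n. hereditary \<O> (\<zeta> n) (H n)"
      "\<And>n. - A n \<subseteq> \<Union>(cells \<O> (H n) (\<zeta> n) (- A n))"
    by metis
  define H' where "H' = (\<Union>n. insert (\<zeta> n, - A n) (H n))"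
  have "hereditary \<O> \<xi> (insert (\<zeta> n, - A n) (H n))" for n
  proof -
    have sub: "\<Union>(cells \<O> (H n) z E) \<subseteq> \<Union>(cells \<O> (insert (\<zeta> n, - A n) (H n)) z E)" for z E
      by (intro Union_mono cells_mono) auto
    show ?thesis
      unfolding hereditary_def
    proof (intro conjI allI impI)
      fix z E assume "(z, E) \<in> insert (\<zeta> n, - A n) (H n)"
      then consider "z = \<zeta> n" "E = - A n" | "(z, E) \<in> H n" by blast
      note cases = this
      show "1 \<le> z"
        using cases by cases (use Union.hyps hereditaryD[OF H(1)] in auto)
      show "z < \<xi>"
        using cases by cases (use Union.hyps(3)[of n] hereditaryD(2)[OF H(1)[of n]] in force)+
      show "E \<in> Sigma0 z"
        using cases by cases (use Union.hyps hereditaryD[OF H(1)] in \<open>auto simp: Sigma0_def\<close>)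
      have "E \<subseteq> \<Union>(cells \<O> (H n) z E)"
        using cases by cases (simp_all only: H(2) hereditaryD(4)[OF H(1)])
      then show "E \<subseteq> \<Union>(cells \<O> (insert (\<zeta> n, - A n) (H n)) z E)"
        using sub by (rule order_trans)
    qed (use H(1) in \<open>simp add: hereditary_def\<close>)
  qed
  then have "hereditary \<O> \<xi> H'"
    unfolding H'_def by (intro hereditary_UN) auto
  moreover have "A n \<in> cells \<O> H' \<xi> (\<Union>n. A n)" for n
    using Union.hyps(3)[of n] unfolding cells_def H'_def by auto
  then have "(\<Union>n. A n) \<subseteq> \<Union>(cells \<O> H' \<xi> (\<Union>n. A n))"
    by blast
  ultimately show ?case by blast
qed

text \<open>A task is a family of sets, met once the chain lies inside a member. The tasks are
  enumerated and the n-th one is met at step n, as in the Rasiowa-Sikorski lemma.\<close>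

lemma generic_chain:
  assumes "countable \<T>" "\<T> \<noteq> {}" "C0 \<in> B" "C0 \<inter> F \<noteq> {}"
    and dense: "\<And>C t. C \<in> B \<Longrightarrow> C \<inter> F \<noteq> {} \<Longrightarrow> t \<in> \<T> \<Longrightarrow> \<exists>T\<in>t. C \<inter> T \<in> B \<and> C \<inter> T \<inter> F \<noteq> {}"
  shows "\<exists>C :: nat \<Rightarrow> 'a set. decseq C \<and> (\<forall>k. C k \<inter> F \<noteq> {}) \<and> (\<forall>t\<in>\<T>. \<exists>k. \<exists>T\<in>t. C k \<subseteq> T)"
proof -
  define t where "t = from_nat_into \<T>"
  have t: "t n \<in> \<T>" for n
    using assms(2) by (simp add: t_def from_nat_into)
  have "\<exists>C. \<forall>n. (C n \<in> B \<and> C n \<inter> F \<noteq> {}) \<and> (C (Suc n) \<subseteq> C n \<and> (\<exists>T\<in>t n. C (Suc n) \<subseteq> T))"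
  proof (rule dependent_nat_choice)
    show "\<exists>D. (D \<in> B \<and> D \<inter> F \<noteq> {}) \<and> D \<subseteq> C \<and> (\<exists>T\<in>t n. D \<subseteq> T)" if "C \<in> B \<and> C \<inter> F \<noteq> {}" for C n
      using dense[of C "t n"] that t by blast
  qed (use assms in blast)
  then obtain C where C: "\<And>n. C n \<inter> F \<noteq> {}" "\<And>n. C (Suc n) \<subseteq> C n" "\<And>n. \<exists>T\<in>t n. C (Suc n) \<subseteq> T"
    by metis
  have "\<exists>k. \<exists>T\<in>u. C k \<subseteq> T" if u: "u \<in> \<T>" for u
  proof -
    have "\<exists>n. u = t n"
      using from_nat_into_surj[OF assms(1) u] unfolding t_def by metis
    then obtain n where "u = t n" ..
    then show ?thesis using C(3)[of n] by auto
  qed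
  then show ?thesis using C(1) decseq_SucI[of C] C(2) by auto
qed

text \<open>
  In a chain that meets all the tasks below, membership of the limit point \<open>x\<close> in a set of \<open>H\<close>
  is decided by a member of the chain, by induction on the rank.
\<close>

lemma generic_point:
  fixes C :: "nat \<Rightarrow> 'a::complete_space set"
  assumes "decseq C" and nonempty: "\<And>k. C k \<noteq> {}"
    and small: "\<And>n. \<exists>k c. C k \<subseteq> ball c (inverse (Suc n))"
    and basis: "topological_basis \<O>"
    and H: "\<And>\<zeta> E. (\<zeta>, E) \<in> H \<Longrightarrow> E \<subseteq> \<Union>(cells \<O> H \<zeta> E)"
    and task: "\<And>\<zeta> E. (\<zeta>, E) \<in> H \<Longrightarrow> \<exists>k. \<exists>T\<in>insert (- E) (cells \<O> H \<zeta> E). C k \<subseteq> T"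
  obtains x where "\<And>k. x \<in> closure (C k)"
    and "\<And>T. open T \<Longrightarrow> x \<in> T \<Longrightarrow> \<exists>k. C k \<subseteq> T"
    and "\<And>\<zeta> E. (\<zeta>, E) \<in> H \<Longrightarrow> x \<in> E \<Longrightarrow> \<exists>k. C k \<subseteq> E"
    and "\<And>\<zeta> E. (\<zeta>, E) \<in> H \<Longrightarrow> x \<notin> E \<Longrightarrow> \<exists>k. C k \<subseteq> - E"
proof -
  have sub: "C l \<subseteq> C k" if "k \<le> l" for k l
    using assms(1) that by (rule decseqD)
  have small': "\<exists>k c. C k \<subseteq> ball c e" if e: "e > 0" for e
  proof -
    obtain n where "inverse (Suc n) < e"
      using reals_Archimedean[OF e] by auto
    then show ?thesis
      using small[of n] by (meson less_imp_le order_trans subset_ball)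
  qed
  have "\<forall>k. \<exists>y. y \<in> C k"
    using nonempty by blast
  then obtain y where y: "\<And>k. y k \<in> C k"
    by metis
  have "Cauchy y"
  proof (rule metric_CauchyI)
    fix e :: real assume "e > 0"
    then obtain k c where kc: "C k \<subseteq> ball c (e/2)"
      using small'[of "e/2"] by auto
    have "dist c (y m) < e/2" if "k \<le> m" for m
      using kc y sub[OF that] by (metis mem_ball subsetD)
    then have "dist (y m) (y n) < e" if "k \<le> m" "k \<le> n" for m n
      using that by (meson dist_commute_lessI dist_triangle_half_r)
    then show "\<exists>M. \<forall>m\<ge>M. \<forall>n\<ge>M. dist (y m) (y n) < e" by blast
  qed
  then obtain x where x: "y \<longlonglongrightarrow> x"
    using Cauchy_convergent convergent_def by blast
  have cl: "x \<in> closure (C k)" for k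
  proof (rule Lim_in_closed_set[OF closed_closure _ _ x])
    show "\<forall>\<^sub>F n in sequentially. y n \<in> closure (C k)"
      using y sub closure_subset by (intro eventually_sequentiallyI[of k]) blast
  qed simp
  have op: "\<exists>k. C k \<subseteq> T" if T: "open T" "x \<in> T" for T
  proof -
    obtain e where e: "e > 0" "ball x e \<subseteq> T"
      using openE[OF T] by blast
    obtain k c where kc: "C k \<subseteq> ball c (e/2)"
      using small'[of "e/2"] e by auto
    have "closure (C k) \<subseteq> cball c (e/2)"
      using kc by (intro closure_minimal) auto
    then have "dist c x \<le> e/2" using cl[of k] by auto
    then have "dist x z < e" if "z \<in> C k" for z
      using subsetD[OF kc that] dist_triangle[of x z c] by (simp add: dist_commute)
    then show ?thesis using e by (intro exI[of _ k]) auto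
  qed
  \<comment> \<open>The two halves are proved together, since each passes to the complement
    \<open>- T\<close> of a cell, where the other half of its membership question is used.\<close>
  have decide: "(x \<in> E \<longrightarrow> (\<exists>k. C k \<subseteq> E)) \<and> (x \<notin> E \<longrightarrow> (\<exists>k. C k \<subseteq> - E))" if "(\<zeta>, E) \<in> H" for \<zeta> E
    using that
  proof (induction \<zeta> arbitrary: E rule: less_induct)
    case (less \<zeta>)
    have "\<exists>k. C k \<subseteq> E" if xE: "x \<in> E"
    proof -
      obtain T where T: "T \<in> cells \<O> H \<zeta> E" "x \<in> T"
        using H[OF less.prems] xE by blast
      have "\<exists>k. C k \<subseteq> T"
      proof (cases "T \<in> \<O>")
        case True
        then show ?thesis using op T topological_basis_open[OF basis] by simp
      next
        case False
        then obtain z where "z < \<zeta>" "(z, - T) \<in> H"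
          using T by (auto simp: cells_def)
        then show ?thesis using less.IH[of z "- T"] T by auto
      qed
      then show ?thesis using cells_subset[OF T(1)] by blast
    qed
    moreover have "\<exists>k. C k \<subseteq> - E" if "x \<notin> E"
    proof (rule ccontr)
      assume "\<not> ?thesis"
      \<comment> \<open>The task for \<open>E\<close> must then have been met through a cell
        \<open>T\<close> of \<open>E\<close>. Either its closure already puts \<open>x\<close> into
        \<open>E\<close>, or \<open>x\<close> lies in the recorded set \<open>- T\<close> and the
        chain would enter both \<open>T\<close> and \<open>- T\<close>.\<close>
      then obtain k T where T: "T \<in> cells \<O> H \<zeta> E" "C k \<subseteq> T"
        using task[OF less.prems] by auto
      then consider "closure T \<subseteq> E" | z where "z < \<zeta>" "(z, - T) \<in> H"
        by (auto simp: cells_def)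
      then show False
      proof cases
        case 1
        then show ?thesis using cl closure_mono[OF T(2)] that by blast
      next
        case 2
        have "x \<in> - T" using that cells_subset[OF T(1)] by blast
        then obtain l where "C l \<subseteq> - T"
          using less.IH[OF 2] by auto
        then have "C (max k l) \<subseteq> T \<inter> - T"
          using T sub[of k "max k l"] sub[of l "max k l"] by auto
        then show ?thesis using nonempty by blast
      qed
    qed
    ultimately show ?case by blast
  qed
  show thesis using that[of x] cl op decide by blast
qed

section \<open>The Hausdorff-Kuratowski theorem in Polish spaces\<close>

lemma Delta0_osuc_subset_difference_class:
  fixes A :: "'a::polish_space set"
  assumes "1 \<le> \<xi>" "A \<in> Delta0 (osuc \<xi>)"
  shows "\<exists>\<eta>\<ge>1. A \<in> difference_class \<eta> (Sigma0 \<xi>)"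
proof -
  have osuc: "1 < osuc \<xi>" using assms(1) by (simp add: less_osuc_iff)
  have split: "\<exists>\<Z>. countable \<Z> \<and> \<Union>\<Z> = S \<and> (\<forall>Z\<in>\<Z>. is_Sigma0 \<xi> (- Z))"
    if S: "S \<in> Sigma0 (osuc \<xi>)" for S :: "'a set"
  proof -
    obtain P where P: "S = (\<Union>n::nat. P n)" "\<And>n. \<exists>\<zeta>. 1 \<le> \<zeta> \<and> \<zeta> < osuc \<xi> \<and> P n \<in> Pi0 \<zeta>"
      using S by (auto simp: Sigma0_eq[OF osuc])
    have "is_Sigma0 \<xi> (- P n)" for n
      using P(2)[of n] Sigma0_mono by (auto simp: less_osuc_iff Pi0_def Sigma0_def)
    then show ?thesis using P(1) by (intro exI[of _ "range P"]) auto
  qed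
  have A: "A \<in> Sigma0 (osuc \<xi>)" "- A \<in> Sigma0 (osuc \<xi>)"
    using assms(2) by (auto simp: Delta0_def Pi0_def)
  obtain P where P: "countable P" "\<Union>P = A" "\<forall>Z\<in>P. is_Sigma0 \<xi> (- Z)"
    using split[OF A(1)] by blast
  obtain Q where Q: "countable Q" "\<Union>Q = - A" "\<forall>Z\<in>Q. is_Sigma0 \<xi> (- Z)"
    using split[OF A(2)] by blast
  define \<Z> where "\<Z> = P \<union> Q"
  have \<Z>: "countable \<Z>" "\<Union>\<Z> = UNIV" "\<And>Z. Z \<in> \<Z> \<Longrightarrow> Z \<subseteq> A \<or> Z \<subseteq> - A"
    using P Q by (auto simp: \<Z>_def)
  obtain \<O> :: "'a set set" where \<O>: "countable \<O>" "topological_basis \<O>"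
    using ex_countable_basis by blast
  have "\<forall>Z\<in>\<Z>. \<exists>H. hereditary \<O> \<xi> H \<and> - Z \<subseteq> \<Union>(cells \<O> H \<xi> (- Z))"
    using ex_hereditary[OF \<O>(2)] P(3) Q(3) by (auto simp: \<Z>_def)
  then obtain h where h: "\<And>Z. Z \<in> \<Z> \<Longrightarrow> hereditary \<O> \<xi> (h Z)"
      "\<And>Z. Z \<in> \<Z> \<Longrightarrow> - Z \<subseteq> \<Union>(cells \<O> (h Z) \<xi> (- Z))"
    by metis
  define H where "H = (\<Union>Z\<in>\<Z>. h Z)"
  have H: "hereditary \<O> \<xi> H"
    unfolding H_def using \<Z>(1) h(1) by (rule hereditary_UN)
  have H_Z: "- Z \<subseteq> \<Union>(cells \<O> H \<xi> (- Z))" if "Z \<in> \<Z>" for Z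
  proof -
    have "cells \<O> (h Z) \<xi> (- Z) \<subseteq> cells \<O> H \<xi> (- Z)"
      using that by (intro cells_mono) (auto simp: H_def)
    then show ?thesis by (rule order_trans[OF h(2)[OF that] Union_mono])
  qed
  have "countable H" using H by (simp add: hereditary_def)
  \<comment> \<open>Including complements makes every recorded set clopen in the topology with
    subbase \<open>G\<close>; ranks below \<open>\<xi>\<close> keep all generators in
    \<open>Sigma0 \<xi>\<close>. Finite intersections give the base \<open>B\<close>.\<close>
  define G where "G = \<O> \<union> snd ` H \<union> uminus ` snd ` H"
  define B where "B = Inter ` {K. finite K \<and> K \<subseteq> G}"
  have "countable G" using \<O> \<open>countable H\<close> by (simp add: G_def)
  then have "countable B"
    unfolding B_def by (intro countable_image countable_Collect_finite_subset)
  have "g \<in> Sigma0 \<xi>" if g: "g \<in> G" for g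
  proof -
    consider "g \<in> \<O>" | \<zeta> where "(\<zeta>, g) \<in> H" | \<zeta> where "(\<zeta>, - g) \<in> H"
      using g by (auto simp: G_def)
    then show ?thesis
    proof cases
      case 1
      then show ?thesis by (intro open_in_Sigma0[OF assms(1)] topological_basis_open[OF \<O>(2)])
    next
      case 2
      then show ?thesis using hereditaryD[OF H 2] Sigma0_mono[of g \<zeta> \<xi>] by simp
    next
      case 3
      then show ?thesis using hereditaryD[OF H 3] Pi0_subset_Sigma0[of \<zeta> \<xi> g] by simp
    qed
  qed
  then have "B \<subseteq> Sigma0 \<xi>"
    unfolding B_def by (auto intro: Sigma0_finite_Inter[OF assms(1)])
  have "UNIV \<in> B"
    unfolding B_def by (intro image_eqI[of _ _ "{}"]) auto
  have B_Int: "C \<inter> g \<in> B" if C: "C \<in> B" and g: "g \<in> G" for C g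
  proof -
    obtain K where "finite K" "K \<subseteq> G" "C = \<Inter>K" using C by (auto simp: B_def)
    then show ?thesis
      unfolding B_def using g by (intro image_eqI[of _ _ "insert g K"]) auto
  qed
  have cells_G: "cells \<O> H \<zeta> S \<subseteq> G" for \<zeta> S
    by (force simp: cells_def G_def image_iff)
  have \<O>_G: "T \<in> G" if "T \<in> \<O>" for T
    using that by (simp add: G_def)
  have neg_G: "- E \<in> G" if "(\<zeta>, E) \<in> H" for \<zeta> E
    using imageI[where f=uminus, OF imageI[where f=snd, OF that]] by (simp add: G_def)
  show ?thesis
  proof (rule difference_class_if_dense[OF assms(1) \<open>countable B\<close> \<open>B \<subseteq> Sigma0 \<xi>\<close>])
    fix V assume V: "V \<subseteq> B" "\<Union>V \<noteq> UNIV"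
    define F where "F = - \<Union>V"
    show "\<exists>C\<in>B. \<not> C \<subseteq> \<Union>V \<and> (C \<subseteq> \<Union>V \<union> A \<or> C \<subseteq> \<Union>V \<union> - A)"
    proof (rule ccontr)
      assume contra: "\<not> ?thesis"
      \<comment> \<open>If no cell settles \<open>A\<close> on \<open>F\<close>, then no piece
        \<open>Z\<close> contains a nonempty relatively open part of \<open>F\<close>, because each
        \<open>Z\<close> lies on one side of \<open>A\<close>.\<close>
      have notin: "\<exists>y. y \<in> C \<inter> F \<and> y \<notin> Z" if "C \<in> B" "C \<inter> F \<noteq> {}" "Z \<in> \<Z>" for C Z
      proof (rule ccontr)
        assume "\<not> ?thesis"
        then have "C \<subseteq> \<Union>V \<union> Z" by (auto simp: F_def)
        then have "C \<subseteq> \<Union>V \<union> A \<or> C \<subseteq> \<Union>V \<union> - A"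
          using \<Z>(3)[OF that(3)] by (meson Un_mono order_refl order_trans)
        moreover have "\<not> C \<subseteq> \<Union>V"
          using that(2) by (auto simp: F_def)
        ultimately show False
          using contra that(1) by meson
      qed
      define ballt where "ballt n = {T\<in>\<O>. \<exists>c. T \<subseteq> ball c (inverse (Suc n))}" for n
      \<comment> \<open>Three kinds of tasks: shrink into small balls, decide each recorded set, and
        leave each piece \<open>Z\<close>.\<close>
      define \<T> where "\<T> = range ballt \<union> (\<lambda>(\<zeta>, E). insert (- E) (cells \<O> H \<zeta> E)) ` H
        \<union> (\<lambda>Z. cells \<O> H \<xi> (- Z)) ` \<Z>"
      have sub_G: "t \<subseteq> G" if "t \<in> \<T>" for t
        using that neg_G by (auto simp: \<T>_def ballt_def \<O>_G dest: subsetD[OF cells_G])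
      have dense: "\<exists>T\<in>t. C \<inter> T \<in> B \<and> C \<inter> T \<inter> F \<noteq> {}"
        if C: "C \<in> B" "C \<inter> F \<noteq> {}" and t: "t \<in> \<T>" for C t
      proof -
        have "\<exists>T\<in>t. \<exists>y\<in>C \<inter> F. y \<in> T"
        proof -
          obtain y where y: "y \<in> C \<inter> F" using C by blast
          consider n where "t = ballt n" | \<zeta> E where "(\<zeta>, E) \<in> H" "t = insert (- E) (cells \<O> H \<zeta> E)"
            | Z where "Z \<in> \<Z>" "t = cells \<O> H \<xi> (- Z)"
            using t by (auto simp: \<T>_def)
          then show ?thesis
          proof cases
            case 1
            have "y \<in> ball y (inverse (Suc n))" by simp
            with \<O>(2) open_ball obtain T where "T \<in> \<O>" "y \<in> T" "T \<subseteq> ball y (inverse (Suc n))"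
              by (rule topological_basisE)
            then have "T \<in> t" "y \<in> T" unfolding 1 ballt_def by blast+
            with y show ?thesis by blast
          next
            case 2
            have "y \<in> - E \<or> y \<in> \<Union>(cells \<O> H \<zeta> E)"
              using hereditaryD(4)[OF H 2(1)] by blast
            then obtain T where "T \<in> t" "y \<in> T" by (auto simp: 2(2))
            with y show ?thesis by blast
          next
            case 3
            obtain z where "z \<in> C \<inter> F" "z \<notin> Z" using notin[OF C 3(1)] by blast
            moreover from this(2) obtain T where "T \<in> t" "z \<in> T"
              using H_Z[OF 3(1)] by (auto simp: 3(2))
            ultimately show ?thesis by blast
          qed
        qed
        then obtain T y where "T \<in> t" "y \<in> C \<inter> F" "y \<in> T" by blast
        moreover from this(1) have "C \<inter> T \<in> B" by (intro B_Int[OF C(1)] subsetD[OF sub_G[OF t]])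
        ultimately show ?thesis by (intro bexI[of _ T]) auto
      qed
      have \<T>: "countable \<T>" "\<T> \<noteq> {}"
        using \<open>countable H\<close> \<Z>(1) by (auto simp: \<T>_def)
      have "UNIV \<inter> F \<noteq> {}"
        using V(2) by (auto simp: F_def)
      then have "\<exists>C :: nat \<Rightarrow> 'a set. decseq C \<and> (\<forall>k. C k \<inter> F \<noteq> {}) \<and> (\<forall>t\<in>\<T>. \<exists>k. \<exists>T\<in>t. C k \<subseteq> T)"
        by (rule generic_chain[OF \<T> \<open>UNIV \<in> B\<close>]) (rule dense)
      then obtain C :: "nat \<Rightarrow> 'a set"
        where C: "decseq C" "\<And>k. C k \<inter> F \<noteq> {}" "\<And>t. t \<in> \<T> \<Longrightarrow> \<exists>k. \<exists>T\<in>t. C k \<subseteq> T"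
        by (elim exE conjE) (rule that, assumption, blast, blast)
      obtain x where x: "\<And>k. x \<in> closure (C k)"
        "\<And>T. open T \<Longrightarrow> x \<in> T \<Longrightarrow> \<exists>k. C k \<subseteq> T"
        "\<And>\<zeta> E. (\<zeta>, E) \<in> H \<Longrightarrow> x \<in> E \<Longrightarrow> \<exists>k. C k \<subseteq> E"
        "\<And>\<zeta> E. (\<zeta>, E) \<in> H \<Longrightarrow> x \<notin> E \<Longrightarrow> \<exists>k. C k \<subseteq> - E"
      proof (rule generic_point[OF C(1) _ _ \<O>(2), of H])
        show "E \<subseteq> \<Union>(cells \<O> H \<zeta> E)" if "(\<zeta>, E) \<in> H" for \<zeta> E
          using H that by (rule hereditaryD)
        show "C k \<noteq> {}" for k using C(2) by blast
        show "\<exists>k c. C k \<subseteq> ball c (inverse (Suc n))" for n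
          using C(3)[of "ballt n"] by (auto simp: \<T>_def ballt_def)
        show "\<exists>k. \<exists>T\<in>insert (- E) (cells \<O> H \<zeta> E). C k \<subseteq> T" if "(\<zeta>, E) \<in> H" for \<zeta> E
        proof (rule C(3))
          show "insert (- E) (cells \<O> H \<zeta> E) \<in> \<T>"
            unfolding \<T>_def by (rule UnI1, rule UnI2, rule image_eqI[OF _ that]) simp
        qed
      qed (rule that; iprover)
      \<comment> \<open>The chain serves as a neighbourhood filter of \<open>x\<close> in the finer
        topology: it enters every generator containing \<open>x\<close>, hence every member of
        \<open>B\<close> containing \<open>x\<close>.\<close>
      have G: "\<exists>k. C k \<subseteq> g" if g: "g \<in> G" "x \<in> g" for g
      proof -
        consider "g \<in> \<O>" | \<zeta> where "(\<zeta>, g) \<in> H" | \<zeta> where "(\<zeta>, - g) \<in> H"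
          using g by (auto simp: G_def)
        then show ?thesis
        proof cases
          case 1
          then show ?thesis using x(2) g(2) topological_basis_open[OF \<O>(2)] by simp
        next
          case 2
          then show ?thesis using x(3)[OF 2] g(2) by simp
        next
          case 3
          then show ?thesis using x(4)[OF 3] g(2) by simp
        qed
      qed
      have "\<exists>k. C k \<subseteq> \<Inter>K" if "finite K" "K \<subseteq> G" "x \<in> \<Inter>K" for K
        using that
      proof (induction K)
        case (insert g K)
        then obtain k l where "C k \<subseteq> g" "C l \<subseteq> \<Inter>K" using G[of g] by auto
        then have "C (max k l) \<subseteq> \<Inter>(insert g K)"
          using decseqD[OF C(1), of k "max k l"] decseqD[OF C(1), of l "max k l"] by auto
        then show ?case by blast
      qed auto
      then have BC: "\<exists>k. C k \<subseteq> D" if "D \<in> B" "x \<in> D" for D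
        using that unfolding B_def by auto
      \<comment> \<open>\<open>F\<close> is closed in the finer topology: a removed cell around
        \<open>x\<close> would contain some \<open>C k\<close>, yet every \<open>C k\<close> meets
        \<open>F\<close>.\<close>
      have "x \<in> F"
      proof (rule ccontr)
        assume "x \<notin> F"
        then obtain D where "D \<in> V" "x \<in> D" by (auto simp: F_def)
        then obtain k where "C k \<subseteq> D" using BC V(1) by blast
        then show False using C(2)[of k] \<open>D \<in> V\<close> by (auto simp: F_def)
      qed
      have "x \<in> \<Union>\<Z>" by (simp add: \<Z>(2))
      then obtain Z where Z: "Z \<in> \<Z>" "x \<in> Z" by blast
      \<comment> \<open>The chain has entered a cell of \<open>- Z\<close>, so the limit
        \<open>x\<close> cannot be in \<open>Z\<close>; but the pieces cover the space.\<close>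
      then obtain k T where T: "T \<in> cells \<O> H \<xi> (- Z)" "C k \<subseteq> T"
        using C(3)[of "cells \<O> H \<xi> (- Z)"] by (auto simp: \<T>_def)
      then consider "closure T \<subseteq> - Z" | \<zeta> where "(\<zeta>, - T) \<in> H"
        by (auto simp: cells_def)
      then show False
      proof cases
        case 1
        then show ?thesis using x(1)[of k] closure_mono[OF T(2)] Z by blast
      next
        case 2
        have "x \<in> - T" using Z cells_subset[OF T(1)] by blast
        then obtain l where "C l \<subseteq> - T" using x(3)[OF 2] by blast
        then have "C (max k l) \<subseteq> T \<inter> - T"
          using T decseqD[OF C(1), of k "max k l"] decseqD[OF C(1), of l "max k l"] by auto
        then show ?thesis using C(2) by blast
      qed
    qed
  qed
qed

text \<open>
  The library has no metric on \<^typ>\<open>nat\<close>; with the discrete one, \<^typ>\<open>baire\<close> becomes an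
  instance of \<^class>\<open>polish_space\<close>.
\<close>

instantiation nat :: metric_space
begin

definition dist_nat :: "nat \<Rightarrow> nat \<Rightarrow> real"
  where "dist_nat m n = (if m = n then 0 else 1)"

definition uniformity_nat :: "(nat \<times> nat) filter"
  where "uniformity_nat = (INF e\<in>{0<..}. principal {(x, y). dist x y < e})"

instance
proof
  have diag: "eventually (\<lambda>(x, y). x = y) (uniformity :: (nat \<times> nat) filter)"
    unfolding uniformity_nat_def
    by (rule eventually_INF1[of 1]) (auto simp: eventually_principal dist_nat_def split: if_splits)
  show "open U \<longleftrightarrow> (\<forall>x\<in>U. \<forall>\<^sub>F (x', y) in uniformity. x' = x \<longrightarrow> y \<in> U)" for U :: "nat set"
    by (auto simp: open_discrete intro: eventually_mono[OF diag])
qed (auto simp: uniformity_nat_def dist_nat_def)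

end

instance nat :: complete_space
proof
  fix X :: "nat \<Rightarrow> nat" assume "Cauchy X"
  then obtain M where M: "\<And>m n. m \<ge> M \<Longrightarrow> n \<ge> M \<Longrightarrow> dist (X m) (X n) < 1"
    using metric_CauchyD[of X 1] by auto
  have "X n = X M" if "n \<ge> M" for n
    using M[OF that order_refl] by (simp add: dist_nat_def split: if_splits)
  then have "X \<longlonglongrightarrow> X M"
    by (intro tendsto_eventually eventually_sequentiallyI[of M])
  then show "convergent X" by (rule convergentI)
qed

instance nat :: polish_space ..

theorem theorem3p2:
  fixes \<xi> :: omega1
  assumes "1 \<le> \<xi>"
  shows "(Delta0 (osuc \<xi>) :: baire set set) = (\<Union>\<eta>\<in>{1..}. difference_class \<eta> (Sigma0 \<xi>))"
  using Delta0_osuc_subset_difference_class[OF assms] difference_class_subset_Delta0[OF assms]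
  by fastforce

end
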